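(* Let $H_0$ and $H_1$ be two separable multilinear normal submodels for the same data vector $x\in\mathbb{R}^p$, where $x$ is the vectorization of a $p_1\times\cdots\times p_K$ array for $H_0$ and of a $q_1\times\cdots\times q_M$ array for $H_1$, with $\prod_{k=1}^K p_k=\prod_{m=1}^M q_m=p$. Suppose $H_0$ is a submodel of $H_1$. Suppose $x = \ell(L_K\otimes\cdots\otimes L_1)\mathrm{vec}(Q)$ and $x = a(A_M\otimes\cdots\otimes A_1)\mathrm{vec}(Z)$ are two HOLQ juniors in vectorized form, corresponding to $H_0$ and $H_1$, respectively, so that $\hat{\sigma}_0^2 = \ell^2/p$ and $\hat{\sigma}_1^2 = a^2/p$ are the MLEs of the scale parameters under $H_0$ and $H_1$, respectively. Then the likelihood ratio test of $H_0$ versus $H_1$ rejects for large values of $\hat{\sigma}_0^2/\hat{\sigma}_1^2$, or equivalently of $\ell / a$; that is, the likelihood ratio (the maximized likelihood under $H_1$ divided by the maximized likelihood under $H_0$) is a strictly increasing function of $\hat{\sigma}_0^2/\hat{\sigma}_1^2$, equivalently of $\ell/a$.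
   Context: $\|\cdot\|$ is the Frobenius (Euclidean) norm. $\mathcal{G}_{r}^+$: $r\times r$ real lower triangular matrices with positive diagonal elements and unit determinant. $\mathcal{D}_{r}^+$: $r\times r$ positive definite diagonal matrices with unit determinant. $\mathcal{G}_{r}^{Ch}$: $r\times r$ lower triangular matrices with unit diagonal. $\mathcal{S}_r^1$: $r\times r$ symmetric positive definite matrices with unit determinant. $\mathcal{S}_r^{Ch}$: $r\times r$ symmetric positive definite matrices whose lower triangular Cholesky square roots have unit diagonal. $\mathrm{vec}$ stacks the entries of an array into a vector, with the first index varying fastest. Separable submodel: given dimensions $p_1,\ldots,p_K$ with product $p$ and a partition of $\{1,\ldots,K\}$ into disjoint (possibly empty) sets $J_1,J_2,J_3,J_4$, the corresponding submodel is $x\sim N_p(0,\sigma^2\Sigma_K\otimes\cdots\otimes\Sigma_1)$ with unknown $\sigma^2>0$ and $\Sigma_k$ in $\mathcal{S}_{p_k}^1$, $\mathcal{D}_{p_k}^+$, $\mathcal{S}_{p_k}^{Ch}$, or $\{I_{p_k}\}$ when $k$ is in $J_1,J_2,J_3$, or $J_4$, respectively. $H_0$ is such a model; $H_1$ is such a model with dimensions $q_1,\ldots,q_M$ and a partition $\tilde J_1,\ldots,\tilde J_4$ of $\{1,\ldots,M\}$ ($M$ may differ from $K$, e.g. when modes are concatenated in $H_1$). $H_0$ is a submodel of $H_1$ if every covariance matrix of $x$ allowed by $H_0$ is allowed by $H_1$. HOLQ junior (vectorized form) corresponding to such a submodel: let $\mathcal{G}^{(k)} = \mathcal{G}_{p_k}^+$,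 $\mathcal{D}_{p_k}^+$, $\mathcal{G}_{p_k}^{Ch}$, or $\{I_{p_k}\}$ if $k$ is in $J_1$, $J_2$, $J_3$, or $J_4$, respectively. If $(L_1,\ldots,L_K)$ minimizes $\|(\tilde L_K^{-1}\otimes\cdots\otimes\tilde L_1^{-1})x\|$ over $\tilde L_k\in\mathcal{G}^{(k)}$, $k=1,\ldots,K$, then $x=\ell(L_K\otimes\cdots\otimes L_1)\mathrm{vec}(Q)$ is a HOLQ junior, where $\ell=\|(L_K^{-1}\otimes\cdots\otimes L_1^{-1})x\|$ (understood to be positive) and $\mathrm{vec}(Q)=(L_K^{-1}\otimes\cdots\otimes L_1^{-1})x/\ell$. The HOLQ junior $a(A_M\otimes\cdots\otimes A_1)\mathrm{vec}(Z)$ for $H_1$ is defined in the same way. *)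

theory Defs
  imports
    Complex_Main
    "HOL-Library.FuncSet"
    "HOL-Library.Disjoint_Sets"
    "Jordan_Normal_Form.Determinant"
    "Jordan_Normal_Form.Gauss_Jordan_Elimination"
begin

definition frobenius_norm :: "real vec \<Rightarrow> real" where
  "frobenius_norm v = sqrt (v \<bullet> v)"

text \<open>Only meaningful for invertible square matrices.\<close>
definition minv :: "real mat \<Rightarrow> real mat" where
  "minv A = the (mat_inverse A)"

definition lower_triangular :: "real mat \<Rightarrow> bool" where
  "lower_triangular A \<longleftrightarrow> (\<forall>i<dim_row A. \<forall>j<dim_col A. i < j \<longrightarrow> A $$ (i, j) = 0)"

definition sym_pos_def :: "nat \<Rightarrow> real mat \<Rightarrow> bool" where
  "sym_pos_def r S \<longleftrightarrow> S \<in> carrier_mat r r \<and> transpose_mat S = S \<and>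
     (\<forall>v\<in>carrier_vec r. v \<noteq> 0\<^sub>v r \<longrightarrow> 0 < v \<bullet> (S *\<^sub>v v))"

definition cholesky_root :: "nat \<Rightarrow> real mat \<Rightarrow> real mat \<Rightarrow> bool" where
  "cholesky_root r L S \<longleftrightarrow> L \<in> carrier_mat r r \<and> lower_triangular L \<and>
     (\<forall>i<r. 0 < L $$ (i, i)) \<and> S = L * transpose_mat L"

definition G_plus :: "nat \<Rightarrow> real mat set" where
  "G_plus r = {L \<in> carrier_mat r r. lower_triangular L \<and> (\<forall>i<r. 0 < L $$ (i, i)) \<and> det L = 1}"

definition D_plus :: "nat \<Rightarrow> real mat set" where
  "D_plus r = {D. sym_pos_def r D \<and> diagonal_mat D \<and> det D = 1}"

definition G_Ch :: "nat \<Rightarrow> real mat set" where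
  "G_Ch r = {L \<in> carrier_mat r r. lower_triangular L \<and> (\<forall>i<r. L $$ (i, i) = 1)}"

definition S_one :: "nat \<Rightarrow> real mat set" where
  "S_one r = {S. sym_pos_def r S \<and> det S = 1}"

definition S_Ch :: "nat \<Rightarrow> real mat set" where
  "S_Ch r = {S. sym_pos_def r S \<and> (\<exists>L. cholesky_root r L S \<and> (\<forall>i<r. L $$ (i, i) = 1))}"

definition kronecker :: "real mat \<Rightarrow> real mat \<Rightarrow> real mat"  (infixl \<open>\<otimes>\<^sub>K\<close> 70) where
  "A \<otimes>\<^sub>K B = mat (dim_row A * dim_row B) (dim_col A * dim_col B)
     (\<lambda>(i, j). A $$ (i div dim_row B, j div dim_col B) * B $$ (i mod dim_row B, j mod dim_col B))"

text \<open>\<open>kron K A\<close> is the product of \<open>A K\<close>, ..., \<open>A 1\<close>, in this (decreasing) order.\<close>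
fun kron :: "nat \<Rightarrow> (nat \<Rightarrow> real mat) \<Rightarrow> real mat" where
  "kron 0 A = 1\<^sub>m 1"
| "kron (Suc k) A = A (Suc k) \<otimes>\<^sub>K kron k A"

text \<open>
  An array is a function on multi-indices, where a multi-index assigns to each mode \<open>k\<close> in
  \<open>{1..K}\<close> an index in \<open>{0..<p k}\<close>. The position \<open>i\<close> in the vectorization is read as a
  mixed-radix number whose least significant digit is the index of mode 1.
\<close>
definition multi_index :: "nat \<Rightarrow> (nat \<Rightarrow> nat) \<Rightarrow> nat \<Rightarrow> (nat \<Rightarrow> nat)" where
  "multi_index K p i = (\<lambda>k\<in>{1..K}. (i div (\<Prod>j=1..<k. p j)) mod p k)"

definition array_vec :: "nat \<Rightarrow> (nat \<Rightarrow> nat) \<Rightarrow> ((nat \<Rightarrow> nat) \<Rightarrow> real) \<Rightarrow> real vec" where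
  "array_vec K p X = vec (\<Prod>k=1..K. p k) (\<lambda>i. X (multi_index K p i))"

text \<open>
  A submodel is given by the number \<open>K\<close> of modes, the dimensions \<open>p 1\<close>, ..., \<open>p K\<close>, and the
  sets \<open>J 1\<close>, ..., \<open>J 4\<close> partitioning the modes.
\<close>
definition separable_submodel :: "nat \<Rightarrow> (nat \<Rightarrow> nat) \<Rightarrow> (nat \<Rightarrow> nat set) \<Rightarrow> bool" where
  "separable_submodel K p J \<longleftrightarrow> 1 \<le> K \<and> (\<forall>k\<in>{1..K}. 1 \<le> p k) \<and>
     disjoint_family_on J {1..4} \<and> (\<Union>i\<in>{1..4}. J i) = {1..K}"

definition cov_factors :: "(nat \<Rightarrow> nat) \<Rightarrow> (nat \<Rightarrow> nat set) \<Rightarrow> nat \<Rightarrow> real mat set" where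
  "cov_factors p J k =
     (if k \<in> J 1 then S_one (p k)
      else if k \<in> J 2 then D_plus (p k)
      else if k \<in> J 3 then S_Ch (p k)
      else {1\<^sub>m (p k)})"

definition cov_params :: "nat \<Rightarrow> (nat \<Rightarrow> nat) \<Rightarrow> (nat \<Rightarrow> nat set) \<Rightarrow> (nat \<Rightarrow> real mat) set" where
  "cov_params K p J = {\<Sigma>. \<forall>k\<in>{1..K}. \<Sigma> k \<in> cov_factors p J k}"

text \<open>Here and below, the parameter \<open>s\<close> is the squared scale (the variance).\<close>
definition covariances :: "nat \<Rightarrow> (nat \<Rightarrow> nat) \<Rightarrow> (nat \<Rightarrow> nat set) \<Rightarrow> real mat set" where
  "covariances K p J = {s \<cdot>\<^sub>m kron K \<Sigma> | s \<Sigma>. 0 < s \<and> \<Sigma> \<in> cov_params K p J}"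

text \<open>Viewed as a function of \<open>C\<close>, this is the likelihood given the data \<open>x\<close>; it assumes a positive definite \<open>C\<close>.\<close>
definition mvn_density :: "real mat \<Rightarrow> real vec \<Rightarrow> real" where
  "mvn_density C x = exp (- (x \<bullet> (minv C *\<^sub>v x)) / 2) / sqrt ((2 * pi) ^ dim_vec x * det C)"

definition is_MLE ::
  "nat \<Rightarrow> (nat \<Rightarrow> nat) \<Rightarrow> (nat \<Rightarrow> nat set) \<Rightarrow> real vec \<Rightarrow> real \<Rightarrow> (nat \<Rightarrow> real mat) \<Rightarrow> bool" where
  "is_MLE K p J x s \<Sigma> \<longleftrightarrow> 0 < s \<and> \<Sigma> \<in> cov_params K p J \<and>
     (\<forall>s'>0. \<forall>\<Sigma>'\<in>cov_params K p J.
        mvn_density (s' \<cdot>\<^sub>m kron K \<Sigma>') x \<le> mvn_density (s \<cdot>\<^sub>m kron K \<Sigma>) x)"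

definition is_scale_MLE ::
  "nat \<Rightarrow> (nat \<Rightarrow> nat) \<Rightarrow> (nat \<Rightarrow> nat set) \<Rightarrow> real vec \<Rightarrow> real \<Rightarrow> bool" where
  "is_scale_MLE K p J x s \<longleftrightarrow> (\<exists>\<Sigma>. is_MLE K p J x s \<Sigma>)"

definition max_likelihood :: "nat \<Rightarrow> (nat \<Rightarrow> nat) \<Rightarrow> (nat \<Rightarrow> nat set) \<Rightarrow> real vec \<Rightarrow> real" where
  "max_likelihood K p J x = (SUP C\<in>covariances K p J. mvn_density C x)"

definition root_factors :: "(nat \<Rightarrow> nat) \<Rightarrow> (nat \<Rightarrow> nat set) \<Rightarrow> nat \<Rightarrow> real mat set" where
  "root_factors p J k =
     (if k \<in> J 1 then G_plus (p k)
      else if k \<in> J 2 then D_plus (p k)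
      else if k \<in> J 3 then G_Ch (p k)
      else {1\<^sub>m (p k)})"

definition root_params :: "nat \<Rightarrow> (nat \<Rightarrow> nat) \<Rightarrow> (nat \<Rightarrow> nat set) \<Rightarrow> (nat \<Rightarrow> real mat) set" where
  "root_params K p J = {L. \<forall>k\<in>{1..K}. L k \<in> root_factors p J k}"

definition whiten :: "nat \<Rightarrow> (nat \<Rightarrow> real mat) \<Rightarrow> real vec \<Rightarrow> real vec" where
  "whiten K L x = kron K (\<lambda>k. minv (L k)) *\<^sub>v x"

definition HOLQ_junior ::
  "nat \<Rightarrow> (nat \<Rightarrow> nat) \<Rightarrow> (nat \<Rightarrow> nat set) \<Rightarrow> real vec \<Rightarrow>
   real \<Rightarrow> (nat \<Rightarrow> real mat) \<Rightarrow> ((nat \<Rightarrow> nat) \<Rightarrow> real) \<Rightarrow> bool" where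
  "HOLQ_junior K p J x l L Q \<longleftrightarrow>
     L \<in> root_params K p J \<and>
     (\<forall>L'\<in>root_params K p J. frobenius_norm (whiten K L x) \<le> frobenius_norm (whiten K L' x)) \<and>
     l = frobenius_norm (whiten K L x) \<and> 0 < l \<and>
     array_vec K p Q = (1 / l) \<cdot>\<^sub>v whiten K L x \<and>
     x = l \<cdot>\<^sub>v (kron K L *\<^sub>v array_vec K p Q)"

text \<open>
  The alternative model \<open>(M, q, J')\<close> is in the numerator; the likelihood ratio test with
  critical value \<open>c\<close> rejects the null model \<open>(K, p, J)\<close> iff this ratio exceeds \<open>c\<close>.
\<close>
definition likelihood_ratio ::
  "nat \<Rightarrow> (nat \<Rightarrow> nat) \<Rightarrow> (nat \<Rightarrow> nat set) \<Rightarrow> nat \<Rightarrow> (nat \<Rightarrow> nat) \<Rightarrow> (nat \<Rightarrow> nat set) \<Rightarrow>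
   real vec \<Rightarrow> real" where
  "likelihood_ratio K p J M q J' x = max_likelihood M q J' x / max_likelihood K p J x"

definition LRT_rejects ::
  "nat \<Rightarrow> (nat \<Rightarrow> nat) \<Rightarrow> (nat \<Rightarrow> nat set) \<Rightarrow> nat \<Rightarrow> (nat \<Rightarrow> nat) \<Rightarrow> (nat \<Rightarrow> nat set) \<Rightarrow>
   real \<Rightarrow> real vec \<Rightarrow> bool" where
  "LRT_rejects K p J M q J' c x \<longleftrightarrow> c < likelihood_ratio K p J M q J' x"

end

theory Submission
  imports Defs
begin

text \<open>
  Whether under the null or the alternative model, the covariance \<open>s \<Sigma>\<close> splits into a scale and a
  Kronecker product of factors of determinant one. Each such factor is \<open>L L\<^sup>T\<close> for an \<open>L\<close> in the
  root set over which the HOLQ junior minimizes, and every such \<open>L\<close> arises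
  (\<open>cov_factor_root_exists\<close>, \<open>gram_in_cov_factors\<close>). Kronecker products are compatible with matrix products,
  transposes and inverses, and Kronecker products of triangular roots again have determinant one.
  Hence the density at \<open>s \<Sigma>\<close> sees the \<open>L\<close> only through the norm \<open>r\<close> of the whitened data, and
  equals a constant times \<open>s\<^bsup>-N/2\<^esup> exp (-r\<^sup>2 / (2 s))\<close> (\<open>density_eq_scale_likelihood\<close>).

  This expression decreases in \<open>r\<close>, so the best \<open>L\<close> is the minimizer, with \<open>r = l\<close>. For \<open>r = l\<close> it
  has the unique maximum \<open>s = l\<^sup>2 / N\<close>, and the maximum is a constant times \<open>l\<^bsup>-N\<^esup>\<close>
  (\<open>HOLQ_junior_maximum_likelihood\<close>). The constant depends on \<open>N\<close> alone, so it cancels between the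
  two models, and the likelihood ratio is \<open>(l / a)\<^sup>N\<close>. The critical values then transform by the
  inverse of this power.
\<close>

section \<open>Kronecker products\<close>

lemma kronecker_carrier:
  "A \<in> carrier_mat a b \<Longrightarrow> B \<in> carrier_mat c d \<Longrightarrow> A \<otimes>\<^sub>K B \<in> carrier_mat (a * c) (b * d)"
  by (auto simp: kronecker_def)

lemma kronecker_index:
  assumes "A \<in> carrier_mat a b" "B \<in> carrier_mat c d" "i < a * c" "j < b * d"
  shows "(A \<otimes>\<^sub>K B) $$ (i, j) = A $$ (i div c, j div d) * B $$ (i mod c, j mod d)"
  using assms by (auto simp: kronecker_def)

lemma div_less_mod_less:
  fixes i n m :: nat
  assumes "i < n * m"
  shows "i div m < n" "i mod m < m"
proof -
  from assms have "m > 0" by (cases m) auto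
  with assms show "i div m < n" "i mod m < m" by (auto simp: less_mult_imp_div_less)
qed

text \<open>Writing an index below \<open>n * m\<close> in two digits is what turns sums and products over the rows of
  a Kronecker product into double ones.\<close>
lemma bij_betw_div_mod:
  "bij_betw (\<lambda>i. (i div m, i mod m)) {0..<n * m} ({0..<n} \<times> {0..<m::nat})"
proof (rule bij_betw_byWitness[where f' = "\<lambda>(i, j). i * m + j"])
  have "i * m + j < n * m" if "i < n" "j < m" for i j
  proof -
    have "i * m + j < Suc i * m" using that by simp
    also have "\<dots> \<le> n * m" using that by (intro mult_le_mono1) simp
    finally show ?thesis .
  qed
  then show "(\<lambda>(i, j). i * m + j) ` ({0..<n} \<times> {0..<m}) \<subseteq> {0..<n * m}" by auto
qed (auto simp: div_less_mod_less)

lemma sum_div_mod: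
  "(\<Sum>i = 0..<n * m. f (i div m) (i mod m)) = (\<Sum>i = 0..<n. \<Sum>j = 0..<m::nat. f i j)"
  using sum.reindex_bij_betw[OF bij_betw_div_mod, of "\<lambda>(i, j). f i j" m n]
  by (simp add: sum.cartesian_product)

lemma prod_div_mod:
  "(\<Prod>i = 0..<n * m. f (i div m) (i mod m)) = (\<Prod>i = 0..<n. \<Prod>j = 0..<m::nat. f i j)"
  using prod.reindex_bij_betw[OF bij_betw_div_mod, of "\<lambda>(i, j). f i j" m n]
  by (simp add: prod.cartesian_product)

lemma kronecker_mult:
  assumes A: "A \<in> carrier_mat a b" and B: "B \<in> carrier_mat d e"
    and C: "C \<in> carrier_mat b c" and D: "D \<in> carrier_mat e f"
  shows "(A \<otimes>\<^sub>K B) * (C \<otimes>\<^sub>K D) = (A * C) \<otimes>\<^sub>K (B * D)"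
proof (rule eq_matI)
  note AB = kronecker_carrier[OF A B] and CD = kronecker_carrier[OF C D]
  have R: "(A * C) \<otimes>\<^sub>K (B * D) \<in> carrier_mat (a * d) (c * f)"
    using assms by (intro kronecker_carrier) auto
  show "dim_row ((A \<otimes>\<^sub>K B) * (C \<otimes>\<^sub>K D)) = dim_row ((A * C) \<otimes>\<^sub>K (B * D))"
    and "dim_col ((A \<otimes>\<^sub>K B) * (C \<otimes>\<^sub>K D)) = dim_col ((A * C) \<otimes>\<^sub>K (B * D))"
    using AB CD R by auto
  fix i j
  assume "i < dim_row ((A * C) \<otimes>\<^sub>K (B * D))" "j < dim_col ((A * C) \<otimes>\<^sub>K (B * D))"
  with R have i: "i < a * d" and j: "j < c * f" by auto
  note ij = div_less_mod_less[OF i] div_less_mod_less[OF j]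
  have "((A \<otimes>\<^sub>K B) * (C \<otimes>\<^sub>K D)) $$ (i, j)
      = (\<Sum>k = 0..<b * e. (A \<otimes>\<^sub>K B) $$ (i, k) * (C \<otimes>\<^sub>K D) $$ (k, j))"
    using AB CD i j by (simp add: scalar_prod_def)
  also have "\<dots> = (\<Sum>k = 0..<b * e.
      A $$ (i div d, k div e) * B $$ (i mod d, k mod e) *
      (C $$ (k div e, j div f) * D $$ (k mod e, j mod f)))"
    using assms i j by (intro sum.cong) (auto simp: kronecker_index)
  also have "\<dots> = (\<Sum>k = 0..<b. \<Sum>l = 0..<e.
      A $$ (i div d, k) * B $$ (i mod d, l) * (C $$ (k, j div f) * D $$ (l, j mod f)))"
    by (rule sum_div_mod)
  also have "\<dots> = (\<Sum>k = 0..<b. A $$ (i div d, k) * C $$ (k, j div f)) *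
      (\<Sum>l = 0..<e. B $$ (i mod d, l) * D $$ (l, j mod f))"
    by (simp add: sum_product mult_ac)
  also have "\<dots> = ((A * C) \<otimes>\<^sub>K (B * D)) $$ (i, j)"
    using assms i j ij
    by (subst kronecker_index[of _ a c _ d f]) (auto simp: scalar_prod_def)
  finally show "((A \<otimes>\<^sub>K B) * (C \<otimes>\<^sub>K D)) $$ (i, j) = ((A * C) \<otimes>\<^sub>K (B * D)) $$ (i, j)" .
qed

lemma kronecker_transpose:
  assumes A: "A \<in> carrier_mat a b" and B: "B \<in> carrier_mat c d"
  shows "transpose_mat (A \<otimes>\<^sub>K B) = transpose_mat A \<otimes>\<^sub>K transpose_mat B"
proof (rule eq_matI)
  fix i j
  assume "i < dim_row (transpose_mat A \<otimes>\<^sub>K transpose_mat B)"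
    "j < dim_col (transpose_mat A \<otimes>\<^sub>K transpose_mat B)"
  with A B have i: "i < b * d" and j: "j < a * c" by (auto simp: kronecker_def)
  with A B show "transpose_mat (A \<otimes>\<^sub>K B) $$ (i, j) =
      (transpose_mat A \<otimes>\<^sub>K transpose_mat B) $$ (i, j)"
    using div_less_mod_less[OF i] div_less_mod_less[OF j] by (auto simp: kronecker_def)
qed (use A B in \<open>auto simp: kronecker_def\<close>)

lemma kronecker_one: "1\<^sub>m a \<otimes>\<^sub>K 1\<^sub>m b = 1\<^sub>m (a * b)"
proof (rule eq_matI)
  fix i j assume "i < dim_row (1\<^sub>m (a * b))" "j < dim_col (1\<^sub>m (a * b))"
  then have ij: "i < a * b" "j < a * b" by auto
  have "i = j \<longleftrightarrow> i div b = j div b \<and> i mod b = j mod b"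
    by (metis div_mult_mod_eq)
  with ij show "(1\<^sub>m a \<otimes>\<^sub>K 1\<^sub>m b) $$ (i, j) = 1\<^sub>m (a * b) $$ (i, j)"
    by (subst kronecker_index[of _ a a _ b b]) (auto simp: div_less_mod_less)
qed (auto simp: kronecker_def)

lemma det_lower_triangular_prod:
  assumes "A \<in> carrier_mat n n" "lower_triangular A"
  shows "det A = (\<Prod>i = 0..<n. A $$ (i, i))"
  using assms det_lower_triangular[of n A]
  by (auto simp: lower_triangular_def prod_list_diag_prod)

text \<open>If \<open>i < j\<close>, one of the two digits of \<open>i\<close> is smaller than that of \<open>j\<close>, so one of the two
  factors of the entry lies above its diagonal.\<close>
lemma kronecker_lower_triangular:
  assumes A: "A \<in> carrier_mat n n" "lower_triangular A"
    and B: "B \<in> carrier_mat m m" "lower_triangular B"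
  shows "lower_triangular (A \<otimes>\<^sub>K B)"
  unfolding lower_triangular_def
proof (intro allI impI)
  fix i j
  assume "i < dim_row (A \<otimes>\<^sub>K B)" "j < dim_col (A \<otimes>\<^sub>K B)" and less: "i < j"
  then have i: "i < n * m" and j: "j < n * m" using kronecker_carrier[OF A(1) B(1)] by auto
  note ij = div_less_mod_less[OF i] div_less_mod_less[OF j]
  \<comment> \<open>Mixed-radix comparison: the leading digit decides, and the last one breaks ties.\<close>
  have "i div m < j div m \<or> i mod m < j mod m"
  proof (rule ccontr)
    assume "\<not> ?thesis"
    then have "j div m * m + j mod m \<le> i div m * m + i mod m"
      by (intro add_mono mult_le_mono1) auto
    with less show False by simp
  qed
  with ij A B have "A $$ (i div m, j div m) = 0 \<or> B $$ (i mod m, j mod m) = 0"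
    by (auto simp: lower_triangular_def)
  then show "(A \<otimes>\<^sub>K B) $$ (i, j) = 0"
    by (auto simp: kronecker_index[OF A(1) B(1) i j])
qed

text \<open>The diagonal of the product consists of all products of a diagonal entry of \<open>A\<close> and one of \<open>B\<close>.
  Only triangular matrices are of interest, since the covariances below have triangular roots.\<close>
lemma det_kronecker_lower_triangular:
  assumes A: "A \<in> carrier_mat n n" "lower_triangular A"
    and B: "B \<in> carrier_mat m m" "lower_triangular B"
  shows "det (A \<otimes>\<^sub>K B) = det A ^ m * det B ^ n"
proof -
  have "det (A \<otimes>\<^sub>K B) = (\<Prod>i = 0..<n * m. (A \<otimes>\<^sub>K B) $$ (i, i))"
    by (rule det_lower_triangular_prod[OF kronecker_carrier[OF A(1) B(1)]
          kronecker_lower_triangular[OF A B]])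
  also have "\<dots> = (\<Prod>i = 0..<n * m. A $$ (i div m, i div m) * B $$ (i mod m, i mod m))"
    by (intro prod.cong refl kronecker_index[OF A(1) B(1)]) auto
  also have "\<dots> = (\<Prod>i = 0..<n. \<Prod>j = 0..<m. A $$ (i, i) * B $$ (j, j))"
    by (rule prod_div_mod)
  also have "\<dots> = det A ^ m * det B ^ n"
    by (simp add: prod.distrib prod_power_distrib
        det_lower_triangular_prod[OF A] det_lower_triangular_prod[OF B])
  finally show ?thesis .
qed

lemma kron_cong: "(\<And>k. k \<in> {1..K} \<Longrightarrow> A k = B k) \<Longrightarrow> kron K A = kron K B"
  by (induction K) auto

lemma kron_carrier:
  "(\<And>k. k \<in> {1..K} \<Longrightarrow> A k \<in> carrier_mat (p k) (p k)) \<Longrightarrow>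
     kron K A \<in> carrier_mat (\<Prod>k=1..K. p k) (\<Prod>k=1..K. p k)"
  using kronecker_carrier by (induction K) (auto simp: mult.commute)

lemma kron_mult:
  assumes "\<And>k. k \<in> {1..K} \<Longrightarrow> A k \<in> carrier_mat (p k) (p k)"
    and "\<And>k. k \<in> {1..K} \<Longrightarrow> B k \<in> carrier_mat (p k) (p k)"
  shows "kron K A * kron K B = kron K (\<lambda>k. A k * B k)"
  using assms
proof (induction K)
  case (Suc K)
  have A: "kron K A \<in> carrier_mat (\<Prod>k=1..K. p k) (\<Prod>k=1..K. p k)"
    using Suc.prems by (intro kron_carrier) auto
  have B: "kron K B \<in> carrier_mat (\<Prod>k=1..K. p k) (\<Prod>k=1..K. p k)"
    using Suc.prems by (intro kron_carrier) auto
  have "kron (Suc K) A * kron (Suc K) B = (A (Suc K) * B (Suc K)) \<otimes>\<^sub>K (kron K A * kron K B)"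
    unfolding kron.simps
    using Suc.prems by (intro kronecker_mult[OF _ A _ B, of _ "p (Suc K)" "p (Suc K)"]) auto
  then show ?case using Suc by simp
qed simp

lemma kron_transpose:
  assumes "\<And>k. k \<in> {1..K} \<Longrightarrow> A k \<in> carrier_mat (p k) (p k)"
  shows "transpose_mat (kron K A) = kron K (\<lambda>k. transpose_mat (A k))"
  using assms
proof (induction K)
  case (Suc K)
  have "kron K A \<in> carrier_mat (\<Prod>k=1..K. p k) (\<Prod>k=1..K. p k)"
    using Suc.prems by (intro kron_carrier) auto
  then show ?case using Suc by (simp add: kronecker_transpose[of _ "p (Suc K)" "p (Suc K)"])
qed simp

lemma kron_one: "kron K (\<lambda>k. 1\<^sub>m (p k)) = 1\<^sub>m (\<Prod>k=1..K. p k)"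
  by (induction K) (auto simp: kronecker_one mult.commute)

lemma kron_lower_triangular_det:
  assumes "\<And>k. k \<in> {1..K} \<Longrightarrow> A k \<in> carrier_mat (p k) (p k)"
    and "\<And>k. k \<in> {1..K} \<Longrightarrow> lower_triangular (A k)"
    and "\<And>k. k \<in> {1..K} \<Longrightarrow> det (A k) = 1"
  shows "lower_triangular (kron K A) \<and> det (kron K A) = 1"
  using assms
proof (induction K)
  case 0
  then show ?case by (auto simp: lower_triangular_def)
next
  case (Suc K)
  have c: "kron K A \<in> carrier_mat (\<Prod>k=1..K. p k) (\<Prod>k=1..K. p k)"
    using Suc.prems by (intro kron_carrier) auto
  have IH: "lower_triangular (kron K A)" "det (kron K A) = 1" using Suc by auto
  have top: "A (Suc K) \<in> carrier_mat (p (Suc K)) (p (Suc K))" "lower_triangular (A (Suc K))"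
    "det (A (Suc K)) = 1" using Suc.prems by auto
  show ?case
    using kronecker_lower_triangular[OF top(1,2) c IH(1)]
      det_kronecker_lower_triangular[OF top(1,2) c IH(1)] IH(2) top(3) by simp
qed

section \<open>Roots of covariance factors\<close>

text \<open>The first column of the root is \<open>(a, b) / sqrt a\<close>, where \<open>(a, b)\<close> is the first column of \<open>S\<close>. What
  it leaves to be factored is the Schur complement \<open>T\<close>, which is again positive definite: its
  quadratic form at \<open>v\<close> is that of \<open>S\<close> at a suitable extension of \<open>v\<close> by a first coordinate. Entry
  functions replace matrices here so that the induction on the size needs no block matrices.\<close>
lemma cholesky_entries:
  fixes S :: "nat \<Rightarrow> nat \<Rightarrow> real"
  assumes "\<And>i j. i < n \<Longrightarrow> j < n \<Longrightarrow> S i j = S j i"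
    and "\<And>v. \<exists>i<n. v i \<noteq> 0 \<Longrightarrow> 0 < (\<Sum>i<n. \<Sum>j<n. v i * S i j * v j)"
  shows "\<exists>L. (\<forall>i<n. 0 < L i i) \<and> (\<forall>i j. i < j \<longrightarrow> L i j = 0) \<and>
           (\<forall>i<n. \<forall>j<n. S i j = (\<Sum>k<n. L i k * L j k))"
  using assms
proof (induction n arbitrary: S)
  case 0
  then show ?case by (intro exI[of _ "\<lambda>i j. 0"]) auto
next
  case (Suc n)
  define a where "a = S 0 0"
  define b where "b j = S 0 (Suc j)" for j
  define T where "T i j = S (Suc i) (Suc j) - b i * b j / a" for i j
  have b_sym: "S (Suc j) 0 = b j" if "j < n" for j
    using Suc.prems(1)[of "Suc j" 0] that by (simp add: b_def)
  have a: "a > 0"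
    using Suc.prems(2)[of "\<lambda>i. if i = 0 then 1 else 0"]
    by (simp add: a_def sum.lessThan_Suc_shift del: sum.lessThan_Suc)
  have T_pos: "0 < (\<Sum>i<n. \<Sum>j<n. v i * T i j * v j)" if v: "\<exists>i<n. v i \<noteq> 0" for v
  proof -
    define c where "c = (\<Sum>j<n. b j * v j)"
    define W where "W = (\<Sum>i<n. \<Sum>j<n. v i * S (Suc i) (Suc j) * v j)"
    \<comment> \<open>The first coordinate that minimizes the quadratic form of \<open>S\<close> over all extensions of \<open>v\<close>.\<close>
    define u where "u = case_nat (- c / a) v"
    have "\<exists>i<Suc n. u i \<noteq> 0"
      using v by (force simp: u_def)
    then have "0 < (\<Sum>i<Suc n. \<Sum>j<Suc n. u i * S i j * u j)" by (rule Suc.prems(2))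
    also have "\<dots> = (- c / a) * a * (- c / a) + (\<Sum>j<n. (- c / a) * (b j * v j))
        + ((\<Sum>i<n. b i * v i * (- c / a)) + W)"
      by (simp add: sum.lessThan_Suc_shift u_def a_def[symmetric] b_def[symmetric] b_sym
          W_def sum.distrib sum_subtractf sum_negf mult_ac del: sum.lessThan_Suc)
    also have "\<dots> = W - c * c / a"
      using a by (simp add: sum_distrib_left[symmetric] sum_distrib_right[symmetric]
          c_def[symmetric] sum_negf divide_simps sum_divide_distrib[symmetric])
    also have "c * c = (\<Sum>i<n. \<Sum>j<n. b i * v i * (b j * v j))"
      by (simp add: c_def sum_product)
    also have "W - (\<Sum>i<n. \<Sum>j<n. b i * v i * (b j * v j)) / a = (\<Sum>i<n. \<Sum>j<n. v i * T i j * v j)"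
      by (simp add: W_def T_def sum_divide_distrib sum_subtractf[symmetric] algebra_simps)
    finally show ?thesis .
  qed
  have "T i j = T j i" if "i < n" "j < n" for i j
    using that Suc.prems(1)[of "Suc i" "Suc j"] by (simp add: T_def)
  from Suc.IH[of T, OF this T_pos] obtain L where
    L: "\<forall>i<n. 0 < L i i" "\<forall>i j. i < j \<longrightarrow> L i j = 0"
      "\<forall>i<n. \<forall>j<n. T i j = (\<Sum>k<n. L i k * L j k)" by blast
  define L' where "L' i j = (case i of 0 \<Rightarrow> (case j of 0 \<Rightarrow> sqrt a | Suc _ \<Rightarrow> 0)
     | Suc i' \<Rightarrow> (case j of 0 \<Rightarrow> b i' / sqrt a | Suc j' \<Rightarrow> L i' j'))" for i j
  have "0 < L' i i" if "i < Suc n" for i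
    using that a L(1) by (cases i) (auto simp: L'_def)
  moreover have "L' i j = 0" if "i < j" for i j
    using that L(2) by (cases i; cases j) (auto simp: L'_def)
  moreover have "S i j = (\<Sum>k<Suc n. L' i k * L' j k)" if "i < Suc n" "j < Suc n" for i j
  proof -
    have "S (Suc i) (Suc j) = b i * b j / a + (\<Sum>k<n. L i k * L j k)" if "i < n" "j < n" for i j
      using L(3) that by (simp add: T_def algebra_simps)
    then show ?thesis
      using that a b_sym
      by (cases i; cases j)
        (auto simp: L'_def sum.lessThan_Suc_shift a_def[symmetric] b_def[symmetric]
          simp del: sum.lessThan_Suc)
  qed
  ultimately show ?case by (intro exI[of _ L']) blast
qed

lemma quadratic_form_expand:
  fixes S :: "real mat"
  assumes "S \<in> carrier_mat n n"
  shows "vec n v \<bullet> (S *\<^sub>v vec n v) = (\<Sum>i<n. \<Sum>j<n. v i * S $$ (i, j) * v j)"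
  using assms
  by (auto simp: scalar_prod_def sum_distrib_left mult.assoc atLeast0LessThan intro!: sum.cong)

lemma cholesky_root_exists:
  assumes "sym_pos_def n S"
  shows "\<exists>L. cholesky_root n L S"
proof -
  from assms have S: "S \<in> carrier_mat n n" and sym: "transpose_mat S = S"
    and pos: "\<And>v. v \<in> carrier_vec n \<Longrightarrow> v \<noteq> 0\<^sub>v n \<Longrightarrow> 0 < v \<bullet> (S *\<^sub>v v)"
    by (auto simp: sym_pos_def_def)
  have "S $$ (i, j) = S $$ (j, i)" if "i < n" "j < n" for i j
    using that S arg_cong[OF sym, of "\<lambda>X. X $$ (j, i)"] by auto
  moreover have "0 < (\<Sum>i<n. \<Sum>j<n. v i * S $$ (i, j) * v j)" if "\<exists>i<n. v i \<noteq> 0" for v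
  proof -
    have "vec n v \<noteq> 0\<^sub>v n" using that by (metis index_vec index_zero_vec(1))
    with pos[of "vec n v"] show ?thesis by (simp add: quadratic_form_expand[OF S])
  qed
  ultimately obtain L where
    L: "\<forall>i<n. 0 < L i i" "\<forall>i j. i < j \<longrightarrow> L i j = 0"
      "\<forall>i<n. \<forall>j<n. S $$ (i, j) = (\<Sum>k<n. L i k * L j k)"
    using cholesky_entries[of n "\<lambda>i j. S $$ (i, j)"] by blast
  have "cholesky_root n (mat n n (\<lambda>(i, j). L i j)) S"
    using L S unfolding cholesky_root_def lower_triangular_def
    by (auto intro!: eq_matI simp: scalar_prod_def atLeast0LessThan)
  then show ?thesis ..
qed

lemma scalar_prod_self_pos:
  fixes w :: "real vec"
  assumes "w \<in> carrier_vec n" "w \<noteq> 0\<^sub>v n"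
  shows "0 < w \<bullet> w"
proof -
  obtain i where "i < n" "w $ i \<noteq> 0" using assms by (metis eq_vecI carrier_vecD index_zero_vec)
  then show ?thesis using assms
    by (auto simp: scalar_prod_def intro!: sum_pos2[of _ i] simp: power2_eq_square[symmetric])
qed

lemma gram_sym_pos_def:
  assumes L: "L \<in> carrier_mat n n" and det: "det L \<noteq> 0"
  shows "sym_pos_def n (L * transpose_mat L)"
  unfolding sym_pos_def_def
proof (intro conjI ballI impI)
  show "transpose_mat (L * transpose_mat L) = L * transpose_mat L"
    using L by (subst transpose_mult[of _ n n _ n]) auto
  fix v :: "real vec" assume v: "v \<in> carrier_vec n" "v \<noteq> 0\<^sub>v n"
  have T: "transpose_mat L \<in> carrier_mat n n" using L by simp
  have "transpose_mat L *\<^sub>v v \<noteq> 0\<^sub>v n"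
    using det v det_0_iff_vec_prod_zero[OF T] det_transpose[OF L] by auto
  then have "0 < (transpose_mat L *\<^sub>v v) \<bullet> (transpose_mat L *\<^sub>v v)"
    using T v by (intro scalar_prod_self_pos[of _ n]) auto
  also have "\<dots> = v \<bullet> (L *\<^sub>v (transpose_mat L *\<^sub>v v))"
    using L T v by (intro transpose_vec_mult_scalar) auto
  also have "\<dots> = v \<bullet> (L * transpose_mat L *\<^sub>v v)"
    using L T v by (subst assoc_mult_mat_vec[of _ n n _ n]) auto
  finally show "0 < v \<bullet> (L * transpose_mat L *\<^sub>v v)" .
qed (use L in auto)

lemma det_gram: "L \<in> carrier_mat n n \<Longrightarrow> det (L * transpose_mat L) = (det L)\<^sup>2"
  by (subst det_mult[of _ n]) (auto simp: det_transpose power2_eq_square)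

lemma sym_pos_def_diag_pos:
  assumes S: "sym_pos_def n S" and i: "i < n"
  shows "0 < S $$ (i, i)"
proof -
  have c: "S \<in> carrier_mat n n" using S by (simp add: sym_pos_def_def)
  have "unit_vec n i \<noteq> (0\<^sub>v n :: real vec)"
    using i by (metis index_unit_vec(2) index_zero_vec(1) zero_neq_one)
  with S have "0 < unit_vec n i \<bullet> (S *\<^sub>v unit_vec n i)" by (simp add: sym_pos_def_def)
  then show ?thesis using c i by simp
qed

lemma diagonal_lower_triangular: "diagonal_mat D \<Longrightarrow> lower_triangular D"
  by (auto simp: diagonal_mat_def lower_triangular_def)

lemma lower_triangular_one: "lower_triangular (1\<^sub>m n)"
  by (auto simp: lower_triangular_def)

lemma root_factor_props:
  assumes "L \<in> root_factors p J k"
  shows "L \<in> carrier_mat (p k) (p k)" "lower_triangular L" "det L = 1"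
proof -
  show c: "L \<in> carrier_mat (p k) (p k)"
    using assms
    by (auto simp: root_factors_def G_plus_def D_plus_def G_Ch_def sym_pos_def_def split: if_splits)
  show "lower_triangular L"
    using assms diagonal_lower_triangular lower_triangular_one
    by (auto simp: root_factors_def G_plus_def D_plus_def G_Ch_def split: if_splits)
  then show "det L = 1"
    using assms det_lower_triangular_prod[OF c]
    by (auto simp: root_factors_def G_plus_def D_plus_def G_Ch_def split: if_splits)
qed

lemma diagonal_gram_entry:
  assumes L: "L \<in> carrier_mat n n" "diagonal_mat L" and "i < n" "j < n"
  shows "(L * transpose_mat L) $$ (i, j) = (if i = j then (L $$ (i, i))\<^sup>2 else (0::real))"
proof -
  have "(L * transpose_mat L) $$ (i, j) = (\<Sum>k = 0..<n. L $$ (i, k) * L $$ (j, k))"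
    using assms by (auto simp: scalar_prod_def)
  also have "\<dots> = (\<Sum>k = 0..<n. if k = i then L $$ (i, i) * L $$ (j, i) else 0)"
    using assms by (intro sum.cong) (auto simp: diagonal_mat_def)
  also have "\<dots> = (if i = j then (L $$ (i, i))\<^sup>2 else 0)"
    using assms by (auto simp: diagonal_mat_def power2_eq_square)
  finally show ?thesis .
qed

text \<open>Half of the correspondence between roots and covariance factors: a Gram matrix of an invertible
  root is positive definite, and its determinant is a square.\<close>
lemma gram_in_cov_factors:
  assumes L: "L \<in> root_factors p J k"
  shows "L * transpose_mat L \<in> cov_factors p J k"
proof -
  note c = root_factor_props[OF L]
  have spd: "sym_pos_def (p k) (L * transpose_mat L)" using c by (simp add: gram_sym_pos_def)
  have det: "det (L * transpose_mat L) = 1" using c by (simp add: det_gram)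
  have "diagonal_mat (L * transpose_mat L)" if "L \<in> D_plus (p k)"
    using that c diagonal_gram_entry[OF c(1)] by (auto simp: D_plus_def diagonal_mat_def)
  then show ?thesis
    using L c spd det
    by (auto simp: root_factors_def cov_factors_def S_one_def D_plus_def S_Ch_def G_Ch_def
        cholesky_root_def split: if_splits)
qed

text \<open>For a diagonal factor the root has to be diagonal as well, so it is the entrywise square root
  rather than a general Cholesky root.\<close>
lemma diagonal_root_exists:
  assumes S: "S \<in> D_plus n"
  shows "\<exists>L \<in> D_plus n. S = L * transpose_mat L"
proof -
  define L where "L = mat n n (\<lambda>(i, j). sqrt (S $$ (i, j)))"
  have c: "S \<in> carrier_mat n n" and diag: "diagonal_mat S" and det: "det S = 1"
    and pos: "\<And>i. i < n \<Longrightarrow> 0 < S $$ (i, i)"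
    using S sym_pos_def_diag_pos by (auto simp: D_plus_def sym_pos_def_def)
  have Lc: "L \<in> carrier_mat n n" and Ld: "diagonal_mat L"
    using diag c by (auto simp: L_def diagonal_mat_def)
  have eq: "S = L * transpose_mat L"
  proof (rule eq_matI)
    fix i j assume "i < dim_row (L * transpose_mat L)" "j < dim_col (L * transpose_mat L)"
    then have ij: "i < n" "j < n" using Lc by auto
    then show "S $$ (i, j) = (L * transpose_mat L) $$ (i, j)"
      unfolding diagonal_gram_entry[OF Lc Ld ij]
      using diag c pos[OF ij(1)] by (auto simp: diagonal_mat_def L_def)
  qed (use c Lc in auto)
  have "det L = (\<Prod>i = 0..<n. sqrt (S $$ (i, i)))"
    using det_lower_triangular_prod[OF Lc diagonal_lower_triangular[OF Ld]] by (simp add: L_def)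
  then have "det L \<ge> 0" using pos by (auto intro!: prod_nonneg simp: less_imp_le)
  moreover have "(det L)\<^sup>2 = 1" using det eq det_gram[OF Lc] by simp
  ultimately have det1: "det L = 1" by (simp add: power2_eq_1_iff)
  have "sym_pos_def n L"
    unfolding sym_pos_def_def
  proof (intro conjI ballI impI)
    show "transpose_mat L = L"
    proof (rule eq_matI)
      fix i j assume "i < dim_row L" "j < dim_col L"
      then show "transpose_mat L $$ (i, j) = L $$ (i, j)"
        using Ld Lc by (cases "i = j") (auto simp: diagonal_mat_def)
    qed (use Lc in auto)
    fix v :: "real vec" assume v: "v \<in> carrier_vec n" "v \<noteq> 0\<^sub>v n"
    then obtain i where i: "i < n" "v $ i \<noteq> 0" by (metis eq_vecI carrier_vecD index_zero_vec)
    have "v \<bullet> (L *\<^sub>v v) = (\<Sum>i<n. \<Sum>j<n. v $ i * L $$ (i, j) * v $ j)"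
    proof -
      have "vec n (\<lambda>i. v $ i) = v" using v by (intro eq_vecI) auto
      then show ?thesis using quadratic_form_expand[OF Lc, of "\<lambda>i. v $ i"] by simp
    qed
    also have "\<dots> = (\<Sum>i<n. \<Sum>j<n. if j = i then sqrt (S $$ (i, i)) * (v $ i)\<^sup>2 else 0)"
      using Ld by (intro sum.cong) (auto simp: L_def diagonal_mat_def power2_eq_square)
    also have "\<dots> = (\<Sum>i<n. sqrt (S $$ (i, i)) * (v $ i)\<^sup>2)" by simp
    also have "\<dots> > 0" using i pos
      by (intro sum_pos2[of _ i]) (auto simp: less_imp_le)
    finally show "0 < v \<bullet> (L *\<^sub>v v)" .
  qed (rule Lc)
  with Ld det1 eq show ?thesis by (auto simp: D_plus_def)
qed

text \<open>The other half of the correspondence. Positivity of the diagonal makes \<open>det L = 1\<close> the only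
  square root of \<open>det S = 1\<close> that can occur.\<close>
lemma cov_factor_root_exists:
  assumes S: "S \<in> cov_factors p J k"
  shows "\<exists>L \<in> root_factors p J k. S = L * transpose_mat L"
proof -
  have "\<exists>L \<in> G_plus (p k). S = L * transpose_mat L" if S1: "S \<in> S_one (p k)"
  proof -
    obtain L where L: "cholesky_root (p k) L S"
      using S1 cholesky_root_exists by (auto simp: S_one_def)
    then have c: "L \<in> carrier_mat (p k) (p k)" "lower_triangular L"
      and pos: "\<And>i. i < p k \<Longrightarrow> 0 < L $$ (i, i)"
      and eq: "S = L * transpose_mat L" by (auto simp: cholesky_root_def)
    have "0 \<le> det L" using pos
      by (auto simp: det_lower_triangular_prod[OF c] less_imp_le intro!: prod_nonneg)
    moreover have "(det L)\<^sup>2 = 1" using S1 eq det_gram[OF c(1)] by (simp add: S_one_def)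
    ultimately have "det L = 1" by (simp add: power2_eq_1_iff)
    with c pos eq show ?thesis by (auto simp: G_plus_def)
  qed
  moreover have "\<exists>L \<in> G_Ch (p k). S = L * transpose_mat L" if "S \<in> S_Ch (p k)"
    using that by (auto simp: S_Ch_def G_Ch_def cholesky_root_def)
  ultimately show ?thesis
    using S diagonal_root_exists by (auto simp: cov_factors_def root_factors_def)
qed

lemma cov_params_root_exists:
  assumes "\<Sigma> \<in> cov_params K p J"
  shows "\<exists>L \<in> root_params K p J. \<forall>k\<in>{1..K}. \<Sigma> k = L k * transpose_mat (L k)"
proof -
  have "\<forall>k\<in>{1..K}. \<exists>L. L \<in> root_factors p J k \<and> \<Sigma> k = L * transpose_mat L"
    using assms cov_factor_root_exists by (fastforce simp: cov_params_def)
  from bchoice[OF this] show ?thesis by (auto simp: root_params_def)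
qed

section \<open>The likelihood as a function of the scale and the whitened norm\<close>

lemma smult_mat_mult_vec:
  "A \<in> carrier_mat n m \<Longrightarrow> v \<in> carrier_vec m \<Longrightarrow> (a \<cdot>\<^sub>m A) *\<^sub>v v = (a :: real) \<cdot>\<^sub>v (A *\<^sub>v v)"
  by (intro eq_vecI) auto

lemma minv_eqI:
  assumes A: "A \<in> carrier_mat n n" and B: "B \<in> carrier_mat n n" and AB: "A * B = 1\<^sub>m n"
  shows "minv A = B"
proof -
  have BA: "B * A = 1\<^sub>m n" by (rule mat_mult_left_right_inverse[OF A B AB])
  have "A \<in> Units (ring_mat TYPE(real) n ())"
    using A B AB BA unfolding Units_def by (auto simp: ring_mat_simps)
  then obtain C where C: "mat_inverse A = Some C"
    using mat_inverse(1)[OF A, of "()"] by fastforce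
  note C' = mat_inverse(2)[OF A this]
  have "C = C * (A * B)" unfolding AB using C' by (metis right_mult_one_mat)
  also have "\<dots> = B" using A B C' by (subst assoc_mult_mat[symmetric, of _ n n _ n _ n]) auto
  finally show ?thesis using C by (simp add: minv_def)
qed

lemma minv_right_inverse:
  assumes A: "A \<in> carrier_mat n n" and det: "det A \<noteq> 0"
  shows "minv A \<in> carrier_mat n n \<and> A * minv A = 1\<^sub>m n"
proof -
  from det_non_zero_imp_unit[OF A det, of "()"] obtain C where C: "mat_inverse A = Some C"
    using mat_inverse(1)[OF A, of "()"] by fastforce
  with mat_inverse(2)[OF A C] show ?thesis by (simp add: minv_def)
qed

text \<open>The Gaussian density \<open>(2 \<pi> s)\<^bsup>-N/2\<^esup> exp (-r\<^sup>2 / (2 s))\<close>, written as the root of an \<open>N\<close>-th power so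
  that its maximization reduces to that of the base.\<close>
definition scale_likelihood :: "nat \<Rightarrow> real \<Rightarrow> real \<Rightarrow> real" where
  "scale_likelihood N r s = sqrt ((exp (- (r\<^sup>2 / (real N * s))) / (2 * pi * s)) ^ N)"

lemma frobenius_norm_square: "(frobenius_norm v)\<^sup>2 = v \<bullet> v"
  by (simp add: frobenius_norm_def scalar_prod_def sum_nonneg)

text \<open>With \<open>G\<close> the Kronecker product of the roots and \<open>W\<close> its inverse, the covariance is
  \<open>s G G\<^sup>T\<close>, with determinant \<open>s\<^sup>N\<close> and inverse \<open>W\<^sup>T W / s\<close>; the quadratic form of the latter at \<open>x\<close> is
  the squared norm of the whitened data \<open>W x\<close> divided by \<open>s\<close>.\<close>
lemma density_eq_scale_likelihood:
  assumes N: "N = (\<Prod>k=1..K. p k)" "0 < N" and L: "L \<in> root_params K p J"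
    and \<Sigma>: "\<And>k. k \<in> {1..K} \<Longrightarrow> \<Sigma> k = L k * transpose_mat (L k)"
    and s: "0 < s" and x: "x \<in> carrier_vec N"
  shows "mvn_density (s \<cdot>\<^sub>m kron K \<Sigma>) x = scale_likelihood N (frobenius_norm (whiten K L x)) s"
proof -
  define G where "G = kron K L"
  define W where "W = kron K (\<lambda>k. minv (L k))"
  have Lk: "L k \<in> carrier_mat (p k) (p k)" "lower_triangular (L k)" "det (L k) = 1"
    if "k \<in> {1..K}" for k
    using L that root_factor_props[of "L k" p J k] by (auto simp: root_params_def)
  have inv: "minv (L k) \<in> carrier_mat (p k) (p k)" "L k * minv (L k) = 1\<^sub>m (p k)"
    if "k \<in> {1..K}" for k
    using minv_right_inverse[OF Lk(1)[OF that]] Lk(3)[OF that] by auto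
  have G: "G \<in> carrier_mat N N"
    unfolding G_def N(1) by (rule kron_carrier) (rule Lk(1))
  have W: "W \<in> carrier_mat N N"
    unfolding W_def N(1) by (rule kron_carrier) (rule inv(1))
  have "G * W = kron K (\<lambda>k. L k * minv (L k))"
    unfolding G_def W_def using Lk(1) inv(1) by (rule kron_mult)
  also have "\<dots> = kron K (\<lambda>k. 1\<^sub>m (p k))" using inv(2) by (intro kron_cong) auto
  finally have GW: "G * W = 1\<^sub>m N" by (simp add: kron_one N(1))
  then have WG: "W * G = 1\<^sub>m N" by (rule mat_mult_left_right_inverse[OF G W])
  have detG: "det G = 1" unfolding G_def using kron_lower_triangular_det[OF Lk] by simp
  have "kron K \<Sigma> = kron K (\<lambda>k. L k * transpose_mat (L k))" using \<Sigma> by (rule kron_cong)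
  also have "\<dots> = G * kron K (\<lambda>k. transpose_mat (L k))"
    unfolding G_def using Lk(1) by (intro kron_mult[symmetric, where p = p]) auto
  also have "\<dots> = G * transpose_mat G"
    unfolding G_def using Lk(1) by (subst kron_transpose[where p = p]) auto
  finally have C: "kron K \<Sigma> = G * transpose_mat G" .
  have T: "transpose_mat G \<in> carrier_mat N N" "transpose_mat W \<in> carrier_mat N N"
    using G W by auto
  have TT: "transpose_mat G * transpose_mat W = 1\<^sub>m N"
    using WG transpose_mult[OF W G] by simp
  have "G * transpose_mat G * (transpose_mat W * W) = G * (transpose_mat G * transpose_mat W) * W"
    using G W T by (simp add: assoc_mult_mat[of _ N N _ N _ N])
  also have "\<dots> = 1\<^sub>m N" using G W TT GW by simp
  finally have CW: "G * transpose_mat G * (transpose_mat W * W) = 1\<^sub>m N" .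
  have inverse: "minv (s \<cdot>\<^sub>m kron K \<Sigma>) = (1 / s) \<cdot>\<^sub>m (transpose_mat W * W)"
  proof (rule minv_eqI[of _ N])
    have "s \<cdot>\<^sub>m kron K \<Sigma> * ((1 / s) \<cdot>\<^sub>m (transpose_mat W * W))
        = (s * (1 / s)) \<cdot>\<^sub>m (G * transpose_mat G * (transpose_mat W * W))"
      unfolding C using G W T
      by (intro eq_matI) auto
    then show "s \<cdot>\<^sub>m kron K \<Sigma> * ((1 / s) \<cdot>\<^sub>m (transpose_mat W * W)) = 1\<^sub>m N"
      using s unfolding CW by (auto intro!: eq_matI)
  qed (use C G W T in auto)
  have "minv (s \<cdot>\<^sub>m kron K \<Sigma>) *\<^sub>v x = (1 / s) \<cdot>\<^sub>v ((transpose_mat W * W) *\<^sub>v x)"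
    unfolding inverse using W T x by (intro smult_mat_mult_vec) auto
  also have "(transpose_mat W * W) *\<^sub>v x = transpose_mat W *\<^sub>v (W *\<^sub>v x)"
    using W T x by (intro assoc_mult_mat_vec) auto
  finally have "x \<bullet> (minv (s \<cdot>\<^sub>m kron K \<Sigma>) *\<^sub>v x) = (1 / s) * (x \<bullet> (transpose_mat W *\<^sub>v (W *\<^sub>v x)))"
    using W T x by simp
  also have "x \<bullet> (transpose_mat W *\<^sub>v (W *\<^sub>v x)) = (W *\<^sub>v x) \<bullet> (W *\<^sub>v x)"
    using transpose_vec_mult_scalar[OF T(2) _ x, of "W *\<^sub>v x"] W x by simp
  also have "\<dots> = (frobenius_norm (whiten K L x))\<^sup>2"
    by (simp add: frobenius_norm_square whiten_def W_def)
  finally have quad: "x \<bullet> (minv (s \<cdot>\<^sub>m kron K \<Sigma>) *\<^sub>v x) = (frobenius_norm (whiten K L x))\<^sup>2 / s"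
    by simp
  have det: "det (s \<cdot>\<^sub>m kron K \<Sigma>) = s ^ N"
    unfolding C using G detG det_gram[OF G] by simp
  define r where "r = frobenius_norm (whiten K L x)"
  have "exp (- (r\<^sup>2 / s) / 2) = sqrt (exp (- (r\<^sup>2 / (real N * s))) ^ N)"
  proof -
    have "exp (- (r\<^sup>2 / (real N * s))) ^ N = exp (- (r\<^sup>2 / s))"
      using N(2) by (simp add: exp_of_nat_mult[symmetric])
    also have "\<dots> = (exp (- (r\<^sup>2 / s) / 2))\<^sup>2"
      by (simp add: power2_eq_square exp_add[symmetric])
    finally show ?thesis by simp
  qed
  moreover have "dim_vec x = N" using x by simp
  ultimately show ?thesis
    unfolding mvn_density_def quad det scale_likelihood_def r_def[symmetric]
    by (simp only: real_sqrt_divide power_divide power_mult_distrib)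
qed

lemma scale_likelihood_antimono:
  assumes "0 < l" "l \<le> r" "0 < s"
  shows "scale_likelihood N r s \<le> scale_likelihood N l s"
proof -
  have "l\<^sup>2 / (real N * s) \<le> r\<^sup>2 / (real N * s)"
    using assms by (intro divide_right_mono power_mono) auto
  then show ?thesis using assms unfolding scale_likelihood_def
    by (intro real_sqrt_le_mono power_mono divide_right_mono) auto
qed

text \<open>In the variable \<open>y = l\<^sup>2 / (N s)\<close> the base is \<open>y exp (-y)\<close> up to a constant factor. It is largest
  at \<open>y = 1\<close> only, because \<open>ln y < y - 1\<close> for all other \<open>y\<close>.\<close>
lemma scale_likelihood_unique_max:
  assumes N: "0 < N" and l: "0 < l" and s: "0 < s" "s \<noteq> l\<^sup>2 / real N"
  shows "scale_likelihood N l s < scale_likelihood N l (l\<^sup>2 / real N)"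
proof -
  define t where "t = l\<^sup>2 / real N"
  define y where "y = t / s"
  have t: "0 < t" and y: "0 < y" "y \<noteq> 1" using assms by (auto simp: t_def y_def field_simps)
  have "ln y < y - 1" using y ln_le_minus_one[of y] ln_eq_minus_one[of y] by fastforce
  then have "exp (ln y) < exp (y - 1)" by simp
  then have "y < exp (y - 1)" using y by simp
  then have "y * exp (- y) < exp (-1)"
    by (simp add: exp_diff exp_minus field_simps)
  then have "y * exp (- y) / (2 * pi * t) < exp (-1) / (2 * pi * t)"
    using t by (intro divide_strict_right_mono) auto
  moreover have "y * exp (- y) / (2 * pi * t) = exp (- (l\<^sup>2 / (real N * s))) / (2 * pi * s)"
    using t s(1) N l by (simp add: y_def t_def divide_simps)
  moreover have "l\<^sup>2 / (real N * t) = 1" using N l by (simp add: t_def)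
  ultimately show ?thesis using N s t unfolding scale_likelihood_def t_def[symmetric]
    by (intro real_sqrt_less_mono power_strict_mono) auto
qed

lemma scale_likelihood_max_value:
  assumes "0 < N" "0 < l"
  shows "scale_likelihood N l (l\<^sup>2 / real N) = sqrt ((exp (-1) / (2 * pi * (l\<^sup>2 / real N))) ^ N)"
  using assms by (simp add: scale_likelihood_def)

section \<open>Maximum likelihood from the HOLQ junior\<close>

text \<open>The roots of the HOLQ junior give a covariance at which the likelihood is \<open>scale_likelihood N l\<close>
  for every scale at once, and no covariance of that scale does better. So maximizing over the
  covariances leaves a problem in the scale alone, even for uniqueness.\<close>
lemma HOLQ_junior_maximum_likelihood:
  assumes N: "N = (\<Prod>k=1..K. p k)" "0 < N" and x: "x \<in> carrier_vec N"
    and H: "HOLQ_junior K p J x l L Q"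
  shows "is_scale_MLE K p J x s \<longleftrightarrow> s = l\<^sup>2 / real N"
    and "max_likelihood K p J x = sqrt ((exp (-1) / (2 * pi * (l\<^sup>2 / real N))) ^ N)"
proof -
  define \<sigma> where "\<sigma> = l\<^sup>2 / real N"
  define \<Sigma>\<^sub>0 where "\<Sigma>\<^sub>0 k = L k * transpose_mat (L k)" for k
  from H have L: "L \<in> root_params K p J" and l: "l = frobenius_norm (whiten K L x)" "0 < l"
    and min: "\<And>L'. L' \<in> root_params K p J \<Longrightarrow> l \<le> frobenius_norm (whiten K L' x)"
    unfolding HOLQ_junior_def by blast+
  have \<sigma>: "0 < \<sigma>" using N(2) l(2) by (simp add: \<sigma>_def)
  have \<Sigma>\<^sub>0: "\<Sigma>\<^sub>0 \<in> cov_params K p J"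
    using L gram_in_cov_factors by (auto simp: cov_params_def root_params_def \<Sigma>\<^sub>0_def)
  have attained: "mvn_density (s \<cdot>\<^sub>m kron K \<Sigma>\<^sub>0) x = scale_likelihood N l s" if "0 < s" for s
    unfolding l(1) by (rule density_eq_scale_likelihood[OF N L \<Sigma>\<^sub>0_def that x])
  have bound: "mvn_density (s \<cdot>\<^sub>m kron K \<Sigma>) x \<le> scale_likelihood N l s"
    if s: "0 < s" and \<Sigma>: "\<Sigma> \<in> cov_params K p J" for s \<Sigma>
  proof -
    from cov_params_root_exists[OF \<Sigma>] obtain L' where
      L': "L' \<in> root_params K p J" "\<And>k. k \<in> {1..K} \<Longrightarrow> \<Sigma> k = L' k * transpose_mat (L' k)"
      by blast
    have "mvn_density (s \<cdot>\<^sub>m kron K \<Sigma>) x = scale_likelihood N (frobenius_norm (whiten K L' x)) s"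
      by (rule density_eq_scale_likelihood[OF N L'(1) _ s x]) (rule L'(2))
    also have "\<dots> \<le> scale_likelihood N l s"
      using l(2) min[OF L'(1)] s by (rule scale_likelihood_antimono)
    finally show ?thesis .
  qed
  have max: "scale_likelihood N l s \<le> scale_likelihood N l \<sigma>" if "0 < s" for s
    using scale_likelihood_unique_max[OF N(2) l(2) that] by (cases "s = \<sigma>") (auto simp: \<sigma>_def)
  show "is_scale_MLE K p J x s \<longleftrightarrow> s = l\<^sup>2 / real N"
    unfolding \<sigma>_def[symmetric]
  proof
    assume "is_scale_MLE K p J x s"
    then obtain \<Sigma> where s: "0 < s" and \<Sigma>: "\<Sigma> \<in> cov_params K p J"
      and opt: "mvn_density (\<sigma> \<cdot>\<^sub>m kron K \<Sigma>\<^sub>0) x \<le> mvn_density (s \<cdot>\<^sub>m kron K \<Sigma>) x"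
      using \<sigma> \<Sigma>\<^sub>0 by (auto simp: is_scale_MLE_def is_MLE_def)
    have "scale_likelihood N l \<sigma> \<le> scale_likelihood N l s"
      using opt bound[OF s \<Sigma>] attained[OF \<sigma>] by simp
    then show "s = \<sigma>"
      using scale_likelihood_unique_max[OF N(2) l(2) s] by (force simp: \<sigma>_def)
  next
    assume "s = \<sigma>"
    moreover have "is_MLE K p J x \<sigma> \<Sigma>\<^sub>0"
      unfolding is_MLE_def attained[OF \<sigma>]
      using \<sigma> \<Sigma>\<^sub>0 bound max order_trans by blast
    ultimately show "is_scale_MLE K p J x s" by (auto simp: is_scale_MLE_def)
  qed
  have "max_likelihood K p J x = scale_likelihood N l \<sigma>"
    unfolding max_likelihood_def
  proof (rule cSup_eq_maximum)
    show "scale_likelihood N l \<sigma> \<in> (\<lambda>C. mvn_density C x) ` covariances K p J"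
      using \<sigma> \<Sigma>\<^sub>0 attained[OF \<sigma>] by (auto simp: covariances_def intro!: rev_image_eqI)
    show "y \<le> scale_likelihood N l \<sigma>" if "y \<in> (\<lambda>C. mvn_density C x) ` covariances K p J" for y
      using that bound max order_trans by (fastforce simp: covariances_def)
  qed
  then show "max_likelihood K p J x = sqrt ((exp (-1) / (2 * pi * (l\<^sup>2 / real N))) ^ N)"
    unfolding \<sigma>_def scale_likelihood_max_value[OF N(2) l(2)] .
qed

section \<open>The likelihood ratio\<close>

theorem theorem7:
  fixes K M N :: nat
    and p q :: "nat \<Rightarrow> nat"
    and J J' :: "nat \<Rightarrow> nat set"
  assumes H0: "separable_submodel K p J"
    and H1: "separable_submodel M q J'"
    and dims: "(\<Prod>k=1..K. p k) = N" "(\<Prod>m=1..M. q m) = N"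
    and submodel: "covariances K p J \<subseteq> covariances M q J'"
  shows "\<exists>(f :: real \<Rightarrow> real) (g :: real \<Rightarrow> real) (t :: real \<Rightarrow> real) (u :: real \<Rightarrow> real).
    strict_mono_on {0<..} f \<and> strict_mono_on {0<..} g \<and>
    (\<forall>x X Y l L Q a A Z.
       x = array_vec K p X \<longrightarrow> x = array_vec M q Y \<longrightarrow>
       HOLQ_junior K p J x l L Q \<longrightarrow> HOLQ_junior M q J' x a A Z \<longrightarrow>
       (let s0 = l\<^sup>2 / real N; s1 = a\<^sup>2 / real N in
          (\<forall>s. is_scale_MLE K p J x s \<longleftrightarrow> s = s0) \<and>
          (\<forall>s. is_scale_MLE M q J' x s \<longleftrightarrow> s = s1) \<and>
          likelihood_ratio K p J M q J' x = f (s0 / s1) \<and>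
          likelihood_ratio K p J M q J' x = g (l / a) \<and>
          (\<forall>c. LRT_rejects K p J M q J' c x \<longleftrightarrow> t c < s0 / s1) \<and>
          (\<forall>c. LRT_rejects K p J M q J' c x \<longleftrightarrow> u c < l / a)))"
proof -
  define g where "g r = r ^ N" for r :: real
  \<comment> \<open>The inverse of \<open>g\<close>. A critical value \<open>c \<le> 0\<close> is always exceeded, so it maps to \<open>0\<close>, which is
    below every \<open>l / a\<close>.\<close>
  define u where "u c = (if c \<le> 0 then 0 else root N c)" for c
  have N: "0 < N"
    unfolding dims(1)[symmetric]
    using H0 by (intro prod_pos) (auto simp: separable_submodel_def Suc_le_eq)
  have g: "g r < g r' \<longleftrightarrow> r < r'" if "0 \<le> r" "0 \<le> r'" for r r'
    using that N power_strict_mono[of r r' N] power_less_imp_less_base[of r N r'] by (auto simp: g_def)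
  have u: "c < g r \<longleftrightarrow> u c < r" if "0 < r" for c r
  proof (cases "c \<le> 0")
    case True
    moreover have "0 < g r" using that by (simp add: g_def)
    ultimately show ?thesis using that by (simp add: u_def)
  next
    case False
    then have "0 \<le> u c" "g (u c) = c" using N by (auto simp: u_def g_def)
    then show ?thesis using g[of "u c" r] that by simp
  qed
  have main: "(\<forall>s. is_scale_MLE K p J x s \<longleftrightarrow> s = l\<^sup>2 / real N) \<and>
      (\<forall>s. is_scale_MLE M q J' x s \<longleftrightarrow> s = a\<^sup>2 / real N) \<and>
      likelihood_ratio K p J M q J' x = g (l / a) \<and>
      (l\<^sup>2 / real N) / (a\<^sup>2 / real N) = (l / a)\<^sup>2 \<and> 0 < l / a"
    if x: "x = array_vec K p X" and H: "HOLQ_junior K p J x l L Q"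
      and H': "HOLQ_junior M q J' x a A Z" for x X l L Q a A Z
  proof -
    have xc: "x \<in> carrier_vec N" using dims(1) by (simp add: x array_vec_def)
    note ml = HOLQ_junior_maximum_likelihood[OF dims(1)[symmetric] N xc H]
    note ml' = HOLQ_junior_maximum_likelihood[OF dims(2)[symmetric] N xc H']
    have pos: "0 < l" "0 < a" using H H' unfolding HOLQ_junior_def by blast+
    have ratio: "(l\<^sup>2 / real N) / (a\<^sup>2 / real N) = (l / a)\<^sup>2"
      using N by (simp add: power_divide)
    have "likelihood_ratio K p J M q J' x =
        sqrt (((exp (-1) / (2 * pi * (a\<^sup>2 / real N))) / (exp (-1) / (2 * pi * (l\<^sup>2 / real N)))) ^ N)"
      unfolding likelihood_ratio_def ml(2) ml'(2) by (simp only: real_sqrt_divide power_divide)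
    also have "(exp (-1) / (2 * pi * (a\<^sup>2 / real N))) / (exp (-1) / (2 * pi * (l\<^sup>2 / real N)))
        = (l / a)\<^sup>2"
      using N pos by (simp add: field_simps)
    also have "sqrt (((l / a)\<^sup>2) ^ N) = (l / a) ^ N"
      using pos by (simp add: real_sqrt_power)
    finally show ?thesis using ml(1) ml'(1) ratio pos by (simp add: g_def)
  qed
  have t: "(u c)\<^sup>2 < r\<^sup>2 \<longleftrightarrow> u c < r" if "0 < r" for c r
    using that N power_strict_mono[of "u c" r 2] power_less_imp_less_base[of "u c" 2 r]
    by (auto simp: u_def)
  show ?thesis
  proof (intro exI conjI allI impI)
    show "strict_mono_on {0<..} (\<lambda>r. g (sqrt r))" and "strict_mono_on {0<..} g"
      by (auto simp: strict_mono_on_def g)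
    fix x X Y l L Q a A Z
    assume "x = array_vec K p X" "HOLQ_junior K p J x l L Q" "HOLQ_junior M q J' x a A Z"
    note * = main[OF this]
    have pos: "0 < l / a" and ratio: "l\<^sup>2 / real N / (a\<^sup>2 / real N) = (l / a)\<^sup>2"
      and LR: "likelihood_ratio K p J M q J' x = g (l / a)"
      using * by blast+
    have root: "sqrt ((l / a)\<^sup>2) = l / a" using pos by (intro real_sqrt_unique) auto
    show "let s0 = l\<^sup>2 / real N; s1 = a\<^sup>2 / real N in
        (\<forall>s. is_scale_MLE K p J x s \<longleftrightarrow> s = s0) \<and>
        (\<forall>s. is_scale_MLE M q J' x s \<longleftrightarrow> s = s1) \<and>
        likelihood_ratio K p J M q J' x = g (sqrt (s0 / s1)) \<and>
        likelihood_ratio K p J M q J' x = g (l / a) \<and>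
        (\<forall>c. LRT_rejects K p J M q J' c x \<longleftrightarrow> (u c)\<^sup>2 < s0 / s1) \<and>
        (\<forall>c. LRT_rejects K p J M q J' c x \<longleftrightarrow> u c < l / a)"
      unfolding Let_def LRT_rejects_def ratio root LR u[OF pos] t[OF pos] using * by blast
  qed
qed

end
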